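(* Let $\tilde{\mathbf s}=(\tilde s_1,\tilde s_2)$ be the vector associated with a nondegenerate quadrilateral $K$, let $\tilde K$ be the corresponding intermediate quadrilateral, and let $\tilde c\in\mathbb R$ satisfy $$\tilde s_1^2+\tilde s_2^2+\tfrac13+\tilde c\,\tilde s_1\tilde s_2\neq 0 .$$ Then the finite element $(\tilde K,\tilde P_{\tilde K}(\tilde c),\tilde\Sigma_{\tilde K})$ is unisolvent, i.e. for every $(\alpha_1,\alpha_2,\alpha_3,\alpha_4)\in\mathbb R^4$ there is exactly one $\tilde p\in\tilde P_{\tilde K}(\tilde c)=\operatorname{Span}\{1,\tilde x_1,\tilde x_2,\tilde\mu(\tilde x_1,\tilde x_2;\tilde c)\}$ whose value at the midpoint $\tilde{\mathbf m}_j$ of the $j$-th edge of $\tilde K$ is $\alpha_j$ for $j=1,2,3,4$.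
   Context: Let $K\subset\mathbb R^2$ be a nondegenerate quadrilateral with consecutive vertices $\mathbf v_1,\mathbf v_2,\mathbf v_3,\mathbf v_4$. Put $A=\frac14(\mathbf v_1-\mathbf v_2-\mathbf v_3+\mathbf v_4,\ \mathbf v_1+\mathbf v_2-\mathbf v_3-\mathbf v_4)$ (a $2\times2$ matrix given by its two columns, assumed invertible), $\mathbf d=\frac14(\mathbf v_1-\mathbf v_2+\mathbf v_3-\mathbf v_4)$ and $\tilde{\mathbf s}=(\tilde s_1,\tilde s_2)=A^{-1}\mathbf d$. Let $\hat K=[-1,1]^2$ have vertices $\hat{\mathbf v}_1=(1,1)$, $\hat{\mathbf v}_2=(-1,1)$, $\hat{\mathbf v}_3=(-1,-1)$, $\hat{\mathbf v}_4=(1,-1)$. The intermediate quadrilateral is $\tilde K=\mathcal S_K(\hat K)$, where $\mathcal S_K(\hat{\mathbf x})=\hat{\mathbf x}+\hat x_1\hat x_2\tilde{\mathbf s}$; it has vertices $\tilde{\mathbf v}_1=\hat{\mathbf v}_1+\tilde{\mathbf s}$, $\tilde{\mathbf v}_2=\hat{\mathbf v}_2-\tilde{\mathbf s}$, $\tilde{\mathbf v}_3=\hat{\mathbf v}_3+\tilde{\mathbf s}$, $\tilde{\mathbf v}_4=\hat{\mathbf v}_4-\tilde{\mathbf s}$. Its edge $\tilde e_j$ is the segment joining $\tilde{\mathbf v}_{j-1}$ and $\tilde{\mathbf v}_j$ (with $\tilde{\mathbf v}_0:=\tilde{\mathbf v}_4$). The midpoints of $\tilde e_1,\dots,\tilde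 e_4$ are $\tilde{\mathbf m}_1=(1,0)$, $\tilde{\mathbf m}_2=(0,1)$, $\tilde{\mathbf m}_3=(-1,0)$, $\tilde{\mathbf m}_4=(0,-1)$, the same as those of $\hat K$. For $\tilde c\in\mathbb R$ define the quartic polynomial $$\tilde\mu(\tilde x_1,\tilde x_2;\tilde c)=-\tfrac53\,\tilde\ell_1(\tilde{\mathbf x})\,\tilde\ell_2(\tilde{\mathbf x})\,\tilde{\mathscr Q}(\tilde{\mathbf x}),$$ where $$\tilde\ell_1(\tilde{\mathbf x})=\tilde x_1-\tilde x_2+\tilde s_2-\tilde s_1,\qquad \tilde\ell_2(\tilde{\mathbf x})=\tilde x_1+\tilde x_2+\tilde s_1+\tilde s_2,$$ $$\tilde{\mathscr Q}(\tilde{\mathbf x})=\left(\tilde x_1+\tfrac25\tilde s_2\right)^2+\left(\tilde x_2+\tfrac25\tilde s_1\right)^2-\tilde r^2+\tilde c\left[\left(\tilde x_1+\tfrac25\tilde s_2\right)\left(\tilde x_2+\tfrac25\tilde s_1\right)+\tfrac6{25}\tilde s_1\tilde s_2\right],$$ with $\tilde r^2:=\frac{6}{25}\left(\frac52-\tilde s_1^2-\tilde s_2^2\right)$. The finite element is the triple $(\tilde K,\tilde P_{\tilde K}(\tilde c),\tilde\Sigma_{\tilde K})$ with $\tilde P_{\tilde K}(\tilde c)=\operatorname{Span}\{1,\tilde x_1,\tilde x_2,\tilde\mu(\tilde x_1,\tilde x_2;\tilde c)\}$ (real span) and degrees of freedom $\tilde\Sigma_{\tilde K}$ the four edge-midpoint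 values $\tilde p\mapsto\tilde p(\tilde{\mathbf m}_j)$, $j=1,\dots,4$. *)

theory Defs
  imports "HOL-Analysis.Analysis" "HOL-Library.Function_Algebras"
begin

(* Vertices, edges and midpoints are indexed by the numeral type 4, whose arithmetic is
   modulo 4.  Hence (4::4) = 0, and the predecessor of the index 1 is 4, which is the
   convention that the 0-th vertex is the 4-th one. *)

definition quad_path :: "(4 \<Rightarrow> real^2) \<Rightarrow> real \<Rightarrow> real^2" where
  "quad_path v = linepath (v 1) (v 2) +++ linepath (v 2) (v 3) +++
                 linepath (v 3) (v 4) +++ linepath (v 4) (v 1)"

(* K is the closed region bounded by a polygon that does not intersect itself and has no
   three collinear vertices.  Neither convexity nor an orientation is imposed. *)
definition nondegenerate_quadrilateral :: "(real^2) set \<Rightarrow> (4 \<Rightarrow> real^2) \<Rightarrow> bool" where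
  "nondegenerate_quadrilateral K v \<longleftrightarrow>
     simple_path (quad_path v) \<and>
     (\<forall>j. \<not> collinear {v (j - 1), v j, v (j + 1)}) \<and>
     K = path_image (quad_path v) \<union> inside (path_image (quad_path v))"

definition A_mat :: "(4 \<Rightarrow> real^2) \<Rightarrow> real^2^2" where
  "A_mat v = transpose (vector [(1/4) *\<^sub>R (v 1 - v 2 - v 3 + v 4),
                                (1/4) *\<^sub>R (v 1 + v 2 - v 3 - v 4)])"

definition d_vec :: "(4 \<Rightarrow> real^2) \<Rightarrow> real^2" where
  "d_vec v = (1/4) *\<^sub>R (v 1 - v 2 + v 3 - v 4)"

definition s_tilde :: "(4 \<Rightarrow> real^2) \<Rightarrow> real^2" where
  "s_tilde v = matrix_inv (A_mat v) *v d_vec v"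

definition K_hat :: "(real^2) set" where
  "K_hat = cbox (vector [-1, -1]) (vector [1, 1])"

definition v_hat :: "4 \<Rightarrow> real^2" where
  "v_hat j = (if j = 1 then vector [1, 1] else if j = 2 then vector [-1, 1]
              else if j = 3 then vector [-1, -1] else vector [1, -1])"

definition S_map :: "real^2 \<Rightarrow> real^2 \<Rightarrow> real^2" where
  "S_map s x = x + (x $ 1 * x $ 2) *\<^sub>R s"

definition K_tilde :: "real^2 \<Rightarrow> (real^2) set" where
  "K_tilde s = S_map s ` K_hat"

definition v_tilde :: "real^2 \<Rightarrow> 4 \<Rightarrow> real^2" where
  "v_tilde s j = S_map s (v_hat j)"

definition m_tilde :: "real^2 \<Rightarrow> 4 \<Rightarrow> real^2" where
  "m_tilde s j = midpoint (v_tilde s (j - 1)) (v_tilde s j)"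

definition ell1 :: "real^2 \<Rightarrow> real^2 \<Rightarrow> real" where
  "ell1 s x = x $ 1 - x $ 2 + s $ 2 - s $ 1"

definition ell2 :: "real^2 \<Rightarrow> real^2 \<Rightarrow> real" where
  "ell2 s x = x $ 1 + x $ 2 + s $ 1 + s $ 2"

definition r2_tilde :: "real^2 \<Rightarrow> real" where
  "r2_tilde s = 6/25 * (5/2 - (s $ 1)\<^sup>2 - (s $ 2)\<^sup>2)"

definition Q_tilde :: "real^2 \<Rightarrow> real \<Rightarrow> real^2 \<Rightarrow> real" where
  "Q_tilde s c x =
     (x $ 1 + 2/5 * s $ 2)\<^sup>2 + (x $ 2 + 2/5 * s $ 1)\<^sup>2 - r2_tilde s
     + c * ((x $ 1 + 2/5 * s $ 2) * (x $ 2 + 2/5 * s $ 1) + 6/25 * s $ 1 * s $ 2)"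

definition mu_tilde :: "real^2 \<Rightarrow> real \<Rightarrow> real^2 \<Rightarrow> real" where
  "mu_tilde s c x = - (5/3) * ell1 s x * ell2 s x * Q_tilde s c x"

definition fun_scale :: "real \<Rightarrow> ('a \<Rightarrow> real) \<Rightarrow> 'a \<Rightarrow> real" where
  "fun_scale a f = (\<lambda>x. a * f x)"

global_interpretation real_fun: vector_space "fun_scale :: real \<Rightarrow> ('a \<Rightarrow> real) \<Rightarrow> 'a \<Rightarrow> real"
  by unfold_locales (auto simp: fun_scale_def fun_eq_iff algebra_simps)

(* Real polynomials in two variables are identified with the functions they induce on the
   whole plane. *)
definition P_tilde :: "real^2 \<Rightarrow> real \<Rightarrow> (real^2 \<Rightarrow> real) set" where
  "P_tilde s c = real_fun.span {\<lambda>x. 1, \<lambda>x. x $ 1, \<lambda>x. x $ 2, mu_tilde s c}"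

definition Sigma_tilde :: "real^2 \<Rightarrow> 4 \<Rightarrow> (real^2 \<Rightarrow> real) \<Rightarrow> real" where
  "Sigma_tilde s j p = p (m_tilde s j)"

(* A finite element is a triple of a domain, a space of shape functions and a finite family
   of degrees of freedom; the domain does not enter the condition of unisolvence. *)
type_synonym ('a, 'n) finite_element =
  "'a set \<times> ('a \<Rightarrow> real) set \<times> ('n \<Rightarrow> ('a \<Rightarrow> real) \<Rightarrow> real)"

definition unisolvent :: "('a, 'n::finite) finite_element \<Rightarrow> bool" where
  "unisolvent E = (case E of (K, P, \<Sigma>) \<Rightarrow>
     \<forall>\<alpha> :: real^'n. \<exists>!p. p \<in> P \<and> (\<forall>j. \<Sigma> j p = \<alpha> $ j))"

lemma v_tilde_eq:
  "v_tilde s 1 = v_hat 1 + s" "v_tilde s 2 = v_hat 2 - s"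
  "v_tilde s 3 = v_hat 3 + s" "v_tilde s 4 = v_hat 4 - s"
  by (simp_all add: v_tilde_def S_map_def v_hat_def)

lemma m_tilde_eq:
  "m_tilde s 1 = vector [1, 0]" "m_tilde s 2 = vector [0, 1]"
  "m_tilde s 3 = vector [-1, 0]" "m_tilde s 4 = vector [0, -1]"
proof -
  have z: "(0::4) = 4" by simp
  show "m_tilde s 1 = vector [1, 0]"
    by (simp add: m_tilde_def z v_tilde_eq midpoint_def v_hat_def vec_eq_iff forall_2 del: zero_neq_numeral)
  show "m_tilde s 2 = vector [0, 1]" "m_tilde s 3 = vector [-1, 0]" "m_tilde s 4 = vector [0, -1]"
    by (simp_all add: m_tilde_def v_tilde_eq midpoint_def v_hat_def vec_eq_iff forall_2)
qed

end

theory Submission imports Defs begin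

text \<open>
  At the edge midpoints an affine function has vanishing alternating sum, and affine functions
  attain every quadruple of values with that property. So the element is unisolvent exactly when
  the alternating sum of the values of \<open>\<mu>\<close> does not vanish, and this sum equals
  \<open>- 8 (s\<^sub>1\<^sup>2 + s\<^sub>2\<^sup>2 + 1/3 + c s\<^sub>1 s\<^sub>2)\<close>.
\<close>

text \<open>Splitting off the four generators one at a time leaves the span of the empty set, which
  is \<open>{0}\<close>.\<close>

lemma mem_P_tilde_iff:
  "p \<in> P_tilde s c \<longleftrightarrow>
     (\<exists>a b d e. p = (\<lambda>x. a + b * x $ 1 + d * x $ 2 + e * mu_tilde s c x))"
proof -
  have "p \<in> P_tilde s c \<longleftrightarrow>
    (\<exists>a b d e. p - fun_scale a (\<lambda>x. 1) - fun_scale b (\<lambda>x. x $ 1)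
       - fun_scale d (\<lambda>x. x $ 2) - fun_scale e (mu_tilde s c) = 0)"
    unfolding P_tilde_def real_fun.span_breakdown_eq real_fun.span_empty by simp
  also have "\<dots> \<longleftrightarrow>
     (\<exists>a b d e. p = (\<lambda>x. a + b * x $ 1 + d * x $ 2 + e * mu_tilde s c x))"
  proof -
    have "p - fun_scale a (\<lambda>x. 1) - fun_scale b (\<lambda>x. x $ 1)
        - fun_scale d (\<lambda>x. x $ 2) - fun_scale e (mu_tilde s c) = 0 \<longleftrightarrow>
      p = (\<lambda>x. a + b * x $ 1 + d * x $ 2 + e * mu_tilde s c x)" for a b d e
      by (simp add: fun_eq_iff fun_scale_def diff_diff_eq)
    then show ?thesis by simp
  qed
  finally show ?thesis .
qed

text \<open>The sign \<open>r\<close> covers two opposite midpoints. As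
  \<open>r\<^sup>2 = 1\<close>, the constants of \<open>Q_tilde\<close> combine (1 - 3/5 = 2/5 and
  4/25 + 6/25 = 2/5), so 2/5 factors out and a quadratic form in \<open>r + s $ 2\<close> and
  \<open>s $ 1\<close> remains.\<close>

lemma mu_tilde_midpoint1:
  assumes "r\<^sup>2 = 1"
  shows "mu_tilde s c (vector [r, 0]) = - (2/3) *
      (((r + s $ 2)\<^sup>2 - (s $ 1)\<^sup>2) *
       ((r + s $ 2)\<^sup>2 + (s $ 1)\<^sup>2 + c * s $ 1 * (r + s $ 2)))"
proof -
  have ell: "ell1 s (vector [r, 0]) * ell2 s (vector [r, 0]) = (r + s $ 2)\<^sup>2 - (s $ 1)\<^sup>2"
    by (simp add: ell1_def ell2_def power2_eq_square algebra_simps)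
  have Q: "Q_tilde s c (vector [r, 0]) =
      2/5 * ((r + s $ 2)\<^sup>2 + (s $ 1)\<^sup>2 + c * s $ 1 * (r + s $ 2))"
    using assms by (simp add: Q_tilde_def r2_tilde_def power2_eq_square add_divide_distrib algebra_simps)
  have mu: "mu_tilde s c x = - (5/3) * (ell1 s x * ell2 s x) * Q_tilde s c x" for x
    by (simp add: mu_tilde_def)
  have "- (5/3) * P * (2/5 * R) = - (2/3) * (P * R)" for P R :: real
    by simp
  then show ?thesis
    unfolding mu ell Q .
qed

text \<open>Exchanging the two coordinates of both \<open>x\<close> and \<open>s\<close> fixes
  \<open>ell2\<close> and \<open>Q_tilde\<close> and negates \<open>ell1\<close>; hence the opposite
  sign of the first factor.\<close>

lemma mu_tilde_midpoint2:
  assumes "r\<^sup>2 = 1"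
  shows "mu_tilde s c (vector [0, r]) = - (2/3) *
      (((s $ 2)\<^sup>2 - (r + s $ 1)\<^sup>2) *
       ((s $ 2)\<^sup>2 + (r + s $ 1)\<^sup>2 + c * s $ 2 * (r + s $ 1)))"
proof -
  have ell: "ell1 s (vector [0, r]) * ell2 s (vector [0, r]) = (s $ 2)\<^sup>2 - (r + s $ 1)\<^sup>2"
    by (simp add: ell1_def ell2_def power2_eq_square algebra_simps)
  have Q: "Q_tilde s c (vector [0, r]) =
      2/5 * ((s $ 2)\<^sup>2 + (r + s $ 1)\<^sup>2 + c * s $ 2 * (r + s $ 1))"
    using assms by (simp add: Q_tilde_def r2_tilde_def power2_eq_square add_divide_distrib algebra_simps)
  have mu: "mu_tilde s c x = - (5/3) * (ell1 s x * ell2 s x) * Q_tilde s c x" for x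
    by (simp add: mu_tilde_def)
  have "- (5/3) * P * (2/5 * R) = - (2/3) * (P * R)" for P R :: real
    by simp
  then show ?thesis
    unfolding mu ell Q .
qed

lemma mu_tilde_alternating_sum:
  "mu_tilde s c (m_tilde s 1) - mu_tilde s c (m_tilde s 2)
     + mu_tilde s c (m_tilde s 3) - mu_tilde s c (m_tilde s 4)
   = - 8 * ((s $ 1)\<^sup>2 + (s $ 2)\<^sup>2 + 1/3 + c * s $ 1 * s $ 2)"
proof -
  \<comment> \<open>The factor -8 is -2/3 times 12.\<close>
  have scale: "- (2/3) * w - - (2/3) * x + - (2/3) * y - - (2/3) * z = - 8 * t"
    if "w - x + y - z = 12 * t" for w x y z t :: real
    using that by simp
  have minus_one: "(- 1)\<^sup>2 = (1::real)"
    by simp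
  \<comment> \<open>The quartic terms cancel, and so do the odd powers of the sign. What is left is
    the even part of the binomial expansions: 12 \<open>a\<^sup>2\<close> + 12
    \<open>b\<^sup>2\<close> + 4, and 12 \<open>a * b\<close> with coefficient
    \<open>c\<close>.\<close>
  have "((1 + b)\<^sup>2 - a\<^sup>2) * ((1 + b)\<^sup>2 + a\<^sup>2 + c * a * (1 + b))
      - (b\<^sup>2 - (1 + a)\<^sup>2) * (b\<^sup>2 + (1 + a)\<^sup>2 + c * b * (1 + a))
      + ((- 1 + b)\<^sup>2 - a\<^sup>2) * ((- 1 + b)\<^sup>2 + a\<^sup>2 + c * a * (- 1 + b))
      - (b\<^sup>2 - (- 1 + a)\<^sup>2) * (b\<^sup>2 + (- 1 + a)\<^sup>2 + c * b * (- 1 + a))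
      = 12 * (a\<^sup>2 + b\<^sup>2 + 1/3 + c * a * b)" for a b :: real
    by (simp add: power2_eq_square algebra_simps)
  from this[of "s $ 2" "s $ 1"] show ?thesis
    unfolding m_tilde_eq mu_tilde_midpoint1[OF one_power2] mu_tilde_midpoint2[OF one_power2]
      mu_tilde_midpoint1[OF minus_one] mu_tilde_midpoint2[OF minus_one]
    by (rule scale)
qed

lemma midpoint_system_solvable:
  fixes m1 m2 m3 m4 :: real
  assumes "m1 - m2 + m3 - m4 \<noteq> 0"
  shows "\<exists>a b d e. a + b + e * m1 = y1 \<and> a + d + e * m2 = y2 \<and>
           a - b + e * m3 = y3 \<and> a - d + e * m4 = y4"
proof -
  \<comment> \<open>The alternating sum of the four equations eliminates \<open>a\<close>,
    \<open>b\<close> and \<open>d\<close>, which forces this value.\<close>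
  define e where "e = (y1 - y2 + y3 - y4) / (m1 - m2 + m3 - m4)"
  have "e * (m1 - m2 + m3 - m4) = y1 - y2 + y3 - y4"
    using assms by (simp add: e_def)
  then have e: "e * m1 - e * m2 + e * m3 - e * m4 = y1 - y2 + y3 - y4"
    by (simp add: algebra_simps)
  \<comment> \<open>Half the sum of the first and third equations gives \<open>a\<close>, half the
    differences of opposite equations give \<open>b\<close> and \<open>d\<close>. The choice of
    \<open>e\<close> makes the other pair yield the same \<open>a\<close>.\<close>
  show ?thesis
    by (rule exI[of _ "(y1 + y3 - e * m1 - e * m3) / 2"],
        rule exI[of _ "(y1 - y3 - e * m1 + e * m3) / 2"],
        rule exI[of _ "(y2 - y4 - e * m2 + e * m4) / 2"], rule exI[of _ e])
       (use e in \<open>simp add: field_simps\<close>)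
qed

lemma midpoint_system_unique:
  fixes m1 m2 m3 m4 :: real
  assumes "m1 - m2 + m3 - m4 \<noteq> 0"
    and "a + b + e * m1 = a' + b' + e' * m1" and "a + d + e * m2 = a' + d' + e' * m2"
    and "a - b + e * m3 = a' - b' + e' * m3" and "a - d + e * m4 = a' - d' + e' * m4"
  shows "a = a' \<and> b = b' \<and> d = d' \<and> e = e'"
proof -
  \<comment> \<open>The same elimination, applied to the difference of the two solutions.\<close>
  have "(e - e') * (m1 - m2 + m3 - m4) = 0"
    using assms(2-) by (simp add: algebra_simps)
  then have "e = e'"
    using assms(1) by simp
  then show ?thesis
    using assms(2-) by simp
qed

theorem theorem2p2:
  fixes K :: "(real^2) set" and v :: "4 \<Rightarrow> real^2" and s :: "real^2" and c :: real
  assumes "nondegenerate_quadrilateral K v"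
    and "invertible (A_mat v)"
    and "s = s_tilde v"
    and "(s $ 1)\<^sup>2 + (s $ 2)\<^sup>2 + 1/3 + c * s $ 1 * s $ 2 \<noteq> 0"
  shows "unisolvent (K_tilde s, P_tilde s c, Sigma_tilde s)"
proof -
  define m where "m j = mu_tilde s c (m_tilde s j)" for j
  have ne: "m 1 - m 2 + m 3 - m 4 \<noteq> 0"
    using assms(4) unfolding m_def mu_tilde_alternating_sum by simp
  have dof: "(\<forall>j. Sigma_tilde s j (\<lambda>x. a + b * x $ 1 + d * x $ 2 + e * mu_tilde s c x) = y $ j) \<longleftrightarrow>
      a + b + e * m 1 = y $ 1 \<and> a + d + e * m 2 = y $ 2 \<and>
      a - b + e * m 3 = y $ 3 \<and> a - d + e * m 4 = y $ 4" for a b d e and y :: "real^4"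
    by (simp add: forall_4 Sigma_tilde_def m_def m_tilde_eq)
  have "\<exists>!p. p \<in> P_tilde s c \<and> (\<forall>j. Sigma_tilde s j p = y $ j)" for y :: "real^4"
  proof (rule ex_ex1I)
    show "\<exists>p. p \<in> P_tilde s c \<and> (\<forall>j. Sigma_tilde s j p = y $ j)"
    proof -
      obtain a b d e where
        "\<forall>j. Sigma_tilde s j (\<lambda>x. a + b * x $ 1 + d * x $ 2 + e * mu_tilde s c x) = y $ j"
        using midpoint_system_solvable[OF ne, of "y $ 1" "y $ 2" "y $ 3" "y $ 4"]
        unfolding dof by blast
      moreover have "(\<lambda>x. a + b * x $ 1 + d * x $ 2 + e * mu_tilde s c x) \<in> P_tilde s c"
        unfolding mem_P_tilde_iff by (intro exI) (rule refl)
      ultimately show ?thesis by blast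
    qed
  next
    fix p q
    assume p: "p \<in> P_tilde s c \<and> (\<forall>j. Sigma_tilde s j p = y $ j)"
      and q: "q \<in> P_tilde s c \<and> (\<forall>j. Sigma_tilde s j q = y $ j)"
    obtain a b d e where pe: "p = (\<lambda>x. a + b * x $ 1 + d * x $ 2 + e * mu_tilde s c x)"
      using p mem_P_tilde_iff by blast
    obtain a' b' d' e' where qe: "q = (\<lambda>x. a' + b' * x $ 1 + d' * x $ 2 + e' * mu_tilde s c x)"
      using q mem_P_tilde_iff by blast
    \<comment> \<open>Both coefficient vectors solve the same linear system, so they agree, and with
      them the functions.\<close>
    have "a = a' \<and> b = b' \<and> d = d' \<and> e = e'"
      using p q unfolding pe qe dof by (intro midpoint_system_unique[OF ne]) simp_all
    then show "p = q"
      by (simp add: pe qe)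
  qed
  then show ?thesis
    by (simp add: unisolvent_def)
qed

end
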